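(* Let $n\geq 1$ be an integer and let $g(t)$ be a complex polynomial of degree exactly $d$ such that every zero of $g(t)$ lies on the circle $|z|=1$. Let $m\geq 0$ be the multiplicity of $1$ as a root of $g(t)$. Let $P(q)=g(E)(q+n-1)_n$, where $E$ is the backward shift operator on polynomials in $q$, $Ef(q)=f(q-1)$, and $(a)_k=a(a-1)\cdots(a-k+1)$ denotes the falling factorial. (a) If $d\leq n-1$, then $P(q)=(q+n-d-1)_{n-d}\,Q(q)$, where $Q(q)$ is a polynomial of degree $d-m$ every zero of which has real part $(d-n+1)/2$. (b) If $d\geq n-1$, then $P(q)$ is a polynomial of degree $n-m$ every zero of which has real part $(d-n+1)/2$.
   Formalization: In (b) the degree and zero claims are stated for m ≤ n; for m > n, where P(q) is identically zero (e.g. n = 1, g(t) = (t−1)^2) and the printed claim fails, it is stated instead that P = 0. *)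

theory Defs
  imports "HOL-Analysis.Analysis" "HOL-Computational_Algebra.Computational_Algebra"
begin

definition falling_factorial :: "'a::comm_ring_1 \<Rightarrow> nat \<Rightarrow> 'a" where
  "falling_factorial a k = (\<Prod>i<k. a - of_nat i)"

definition backward_shift :: "'a::comm_ring_1 poly \<Rightarrow> 'a poly" where
  "backward_shift f = pcompose f [:-1, 1:]"

lemma poly_backward_shift: "poly (backward_shift f) x = poly f (x - 1)"
  by (simp add: backward_shift_def poly_pcompose)

text \<open>For a polynomial \<open>g\<close> with coefficients \<open>c\<^sub>i\<close> and an operator \<open>T\<close>, this is
  \<open>g(T) f\<close>, the sum of the \<open>c\<^sub>i T\<^sup>i f\<close>.\<close>

definition poly_of_operator ::
    "'a::comm_ring_1 poly \<Rightarrow> ('a poly \<Rightarrow> 'a poly) \<Rightarrow> 'a poly \<Rightarrow> 'a poly" where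
  "poly_of_operator g T f = (\<Sum>i\<le>degree g. smult (coeff g i) ((T ^^ i) f))"

text \<open>\<open>(q + c)\<^sub>k\<close> as a polynomial in the indeterminate \<open>q\<close>.\<close>

definition falling_factorial_poly :: "'a::comm_ring_1 \<Rightarrow> nat \<Rightarrow> 'a poly" where
  "falling_factorial_poly c k = falling_factorial [:c, 1:] k"

lemma poly_falling_factorial_poly:
  "poly (falling_factorial_poly c k) q = falling_factorial (q + c) k"
  by (simp add: falling_factorial_poly_def falling_factorial_def poly_prod add.commute)

end

theory Submission
  imports Defs
begin

text \<open>Peel off the zeros \<open>u\<close> of \<open>g\<close> one at a time: each of them replaces \<open>P(q)\<close> by
  \<open>u P(q) - P(q - 1)\<close>. If the zeros of \<open>P\<close> lie on a vertical line \<open>Re z = c\<close>, then off the line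
  \<open>Re z = c + 1/2\<close> every zero of \<open>P\<close> is strictly closer to one of \<open>z\<close>, \<open>z - 1\<close> than to the other,
  always the same one; hence \<open>\<bar>P(z)\<bar> \<noteq> \<bar>P(z - 1)\<bar>\<close>, and the new zeros lie on \<open>Re z = c + 1/2\<close>. As
  long as \<open>d \<le> n - 1\<close>, the real zeros of the falling factorial lose one element in each step, and
  the two linear factors \<open>q + n - d - 1\<close> and \<open>q - 1\<close> left over from it have their zeros placed
  symmetrically about the new line.\<close>

subsection \<open>The backward shift\<close>

lemma backward_shift_0 [simp]: "backward_shift 0 = 0"
  by (simp add: backward_shift_def)

lemma backward_shift_smult: "backward_shift (smult a f) = smult a (backward_shift f)"
  by (simp add: backward_shift_def pcompose_smult)

lemma backward_shift_mult: "backward_shift (f * g) = backward_shift f * backward_shift g"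
  by (simp add: backward_shift_def pcompose_mult)

lemma backward_shift_sum: "backward_shift (sum f A) = (\<Sum>i\<in>A. backward_shift (f i))"
  by (simp add: backward_shift_def pcompose_sum)

lemma backward_shift_prod: "backward_shift (prod f A) = (\<Prod>i\<in>A. backward_shift (f i))"
  by (simp add: backward_shift_def pcompose_prod)

lemma backward_shift_pCons: "backward_shift (pCons a f) = [:a:] + [:-1, 1:] * backward_shift f"
  by (simp add: backward_shift_def pcompose_pCons)

lemma degree_backward_shift [simp]:
  "degree (backward_shift f) = degree (f :: 'a::idom poly)"
  by (simp add: backward_shift_def degree_pcompose)

lemma lead_coeff_backward_shift [simp]:
  "coeff (backward_shift f) (degree f) = lead_coeff (f :: 'a::idom poly)"
  using lead_coeff_comp[of "[:-1, 1:]" f] by (simp add: backward_shift_def degree_pcompose)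

lemma coeff_backward_shift:
  fixes f :: "'a::idom poly"
  assumes "degree f \<le> k"
  shows "coeff (backward_shift f) k = coeff f k"
  using assms by (cases "degree f = k") (auto simp: coeff_eq_0)

text \<open>Discrete analogue of differentiation: from f = a + q g one gets f - Ef = q (g - Eg) +
  Eg, a product rule. The degree is only bounded, not prescribed, so that the induction over the
  coefficients goes through.\<close>

lemma backward_difference_coeff:
  fixes f :: "'a::idom poly"
  assumes "degree f \<le> Suc k"
  shows "degree (f - backward_shift f) \<le> k \<and>
         coeff (f - backward_shift f) k = of_nat (Suc k) * coeff f (Suc k)"
  using assms
proof (induction f arbitrary: k)
  case 0
  then show ?case by simp
next
  case (pCons a g)
  have deg: "degree g \<le> k"
    using pCons.prems by (cases "g = 0") auto
  have eq: "pCons a g - backward_shift (pCons a g) =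
            pCons 0 (g - backward_shift g) + backward_shift g"
    by (simp add: backward_shift_pCons algebra_simps)
  show ?case
  proof (cases k)
    case 0
    then obtain b where "g = [:b:]"
      using deg degree_eq_zeroE by blast
    then show ?thesis
      using 0 by (simp add: backward_shift_pCons)
  next
    case (Suc l)
    have IH: "degree (g - backward_shift g) \<le> l"
      "coeff (g - backward_shift g) l = of_nat (Suc l) * coeff g (Suc l)"
      using pCons.IH[of l] deg Suc by auto
    have "degree (pCons 0 (g - backward_shift g) + backward_shift g) \<le> k"
      using IH(1) deg Suc
      by (intro degree_add_le) (auto intro: order_trans[OF degree_pCons_le])
    moreover have "coeff (pCons 0 (g - backward_shift g) + backward_shift g) k =
        of_nat (Suc k) * coeff (pCons a g) (Suc k)"
      using IH(2) Suc coeff_backward_shift[OF deg] by (simp add: algebra_simps)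
    ultimately show ?thesis
      unfolding eq by blast
  qed
qed

lemma degree_backward_difference:
  fixes f :: "'a::{idom, ring_char_0} poly"
  assumes "degree f \<noteq> 0"
  shows "f - backward_shift f \<noteq> 0" "degree (f - backward_shift f) = degree f - 1"
proof -
  obtain k where k: "degree f = Suc k"
    using assms not0_implies_Suc by blast
  then have "coeff f (Suc k) \<noteq> 0"
    by (metis degree_0 leading_coeff_0_iff nat.distinct(1))
  moreover have "coeff (f - backward_shift f) k = of_nat (Suc k) * coeff f (Suc k)"
    and le: "degree (f - backward_shift f) \<le> k"
    using backward_difference_coeff[of f k] k by auto
  ultimately have nz: "coeff (f - backward_shift f) k \<noteq> 0"
    by (metis mult_eq_0_iff of_nat_eq_0_iff nat.distinct(1))
  then show "f - backward_shift f \<noteq> 0"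
    by force
  show "degree (f - backward_shift f) = degree f - 1"
    using le le_degree[OF nz] k by simp
qed

lemma degree_smult_minus_backward_shift:
  fixes f :: "'a::idom poly"
  assumes "f \<noteq> 0" "u \<noteq> 1"
  shows "smult u f - backward_shift f \<noteq> 0" "degree (smult u f - backward_shift f) = degree f"
proof -
  have "coeff (smult u f - backward_shift f) (degree f) = (u - 1) * lead_coeff f"
    by (simp add: algebra_simps)
  then have nz: "coeff (smult u f - backward_shift f) (degree f) \<noteq> 0"
    using assms by simp
  then show "smult u f - backward_shift f \<noteq> 0"
    by force
  have "degree (smult u f - backward_shift f) \<le> degree f"
    by (intro degree_diff_le) (auto intro: degree_smult_le)
  with le_degree[OF nz] show "degree (smult u f - backward_shift f) = degree f"
    by simp
qed

subsection \<open>Polynomials in the backward shift\<close>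

lemma smult_sum_right: "smult a (sum f A) = (\<Sum>i\<in>A. smult a (f i))"
  by (induction A rule: infinite_finite_induct) (auto simp: smult_add_right)

lemma poly_of_operator_atMost:
  assumes "degree g \<le> N"
  shows "poly_of_operator g T f = (\<Sum>i\<le>N. smult (coeff g i) ((T ^^ i) f))"
  unfolding poly_of_operator_def
  by (rule sum.mono_neutral_left) (use assms in \<open>auto simp: coeff_eq_0\<close>)

text \<open>Multiplicativity of g(E) in g, for the one kind of factor that
  \<open>poly_root_induct\<close> splits off. It turns every induction over the zeros of
  \<open>g\<close> into a step P(q) to u P(q) - P(q - 1).\<close>

lemma poly_of_operator_backward_shift_linear_factor:
  fixes g :: "'a::idom poly"
  shows "poly_of_operator ([:u, -1:] * g) backward_shift f =
    smult u (poly_of_operator g backward_shift f) -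
    backward_shift (poly_of_operator g backward_shift f)"
proof -
  let ?E = "backward_shift :: 'a poly \<Rightarrow> _" and ?N = "degree g"
  have "degree ([:u, -1:] * g) \<le> Suc ?N"
    by (rule order_trans[OF degree_mult_le]) simp
  moreover have "[:u, -1:] * g = smult u g - pCons 0 g"
    by simp
  ultimately have "poly_of_operator ([:u, -1:] * g) ?E f =
      (\<Sum>i\<le>Suc ?N. smult (u * coeff g i - coeff (pCons 0 g) i) ((?E ^^ i) f))"
    by (simp only: poly_of_operator_atMost coeff_diff coeff_smult)
  also have "\<dots> = smult u (\<Sum>i\<le>Suc ?N. smult (coeff g i) ((?E ^^ i) f)) -
      (\<Sum>i\<le>Suc ?N. smult (coeff (pCons 0 g) i) ((?E ^^ i) f))"
    unfolding smult_diff_left sum_subtractf smult_sum_right smult_smult by simp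
  \<comment> \<open>The term at index 0 vanishes; the remaining ones carry one extra application of
    E.\<close>
  also have "(\<Sum>i\<le>Suc ?N. smult (coeff (pCons 0 g) i) ((?E ^^ i) f)) =
      (\<Sum>i\<le>?N. smult (coeff g i) ((?E ^^ Suc i) f))"
    unfolding sum.atMost_Suc_shift by simp
  also have "\<dots> = ?E (poly_of_operator g ?E f)"
    unfolding poly_of_operator_def by (simp add: backward_shift_sum backward_shift_smult)
  also have "(\<Sum>i\<le>Suc ?N. smult (coeff g i) ((?E ^^ i) f)) = poly_of_operator g ?E f"
    by (rule poly_of_operator_atMost[symmetric]) simp
  finally show ?thesis .
qed

lemma poly_of_operator_const: "poly_of_operator [:a:] T f = smult a f"
  by (simp add: poly_of_operator_def)

lemma order_linear_factor:
  fixes g :: "'a::idom poly"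
  assumes "g \<noteq> 0"
  shows "order a ([:u, -1:] * g) = (if a = u then 1 else 0) + order a g"
proof -
  have "[:u, -1:] = smult (-1) [:-u, 1:]"
    by simp
  then have "order a [:u, -1:] = order a [:-u, 1:]"
    by (metis order_smult neg_equal_0_iff_equal one_neq_zero)
  then have "order a [:u, -1:] = (if a = u then 1 else 0)"
    using order_power_n_n[of u 1] by (auto simp: order_0I)
  moreover have "[:u, -1:] * g \<noteq> 0"
    unfolding mult_eq_0_iff using assms by simp
  ultimately show ?thesis
    by (simp add: order_mult del: mult_pCons_left)
qed

text \<open>A factor u - E with u different from 1 preserves the degree, since it multiplies the
  leading coefficient by u - 1. A factor 1 - E lowers the degree by one, and kills
  constants.\<close>

lemma degree_poly_of_operator_backward_shift:
  fixes f g :: "complex poly"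
  assumes "g \<noteq> 0" "f \<noteq> 0"
  defines "P \<equiv> poly_of_operator g backward_shift f"
  shows "if order 1 g \<le> degree f then P \<noteq> 0 \<and> degree P = degree f - order 1 g else P = 0"
  using assms(1) unfolding P_def
proof (induction g rule: poly_root_induct[where P = "\<lambda>_. True"])
  case 0
  then show ?case by simp
next
  case (no_roots p)
  then have "constant (poly p)"
    using fundamental_theorem_of_algebra by blast
  then obtain c where "p = [:c:]"
    by (metis constant_degree degree_eq_zeroE)
  then show ?case
    using no_roots \<open>f \<noteq> 0\<close> by (auto simp: poly_of_operator_const order_0I)
next
  case (root u g)
  then have "g \<noteq> 0"
    by auto
  note IH = root.IH[OF \<open>g \<noteq> 0\<close>]
  let ?P = "poly_of_operator g backward_shift f"
  note step = poly_of_operator_backward_shift_linear_factor[of u g f]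
  note ord = order_linear_factor[OF \<open>g \<noteq> 0\<close>, of 1 u]
  consider "degree f < order 1 g" | "order 1 g \<le> degree f" "u \<noteq> 1"
    | "order 1 g < degree f" "u = 1" | "order 1 g = degree f" "u = 1"
    by linarith
  then show ?case
  proof cases
    case 1
    then show ?thesis using IH unfolding step ord by simp
  next
    case 2
    then show ?thesis
      using IH degree_smult_minus_backward_shift[of ?P u] unfolding step ord by simp
  next
    case 3
    then show ?thesis
      using IH degree_backward_difference[of ?P] unfolding step ord by simp
  next
    case 4
    then obtain a where "?P = [:a:]"
      using IH by (metis degree_eq_zeroE diff_self_eq_0 order_refl)
    then show ?thesis
      using 4 unfolding step ord by (simp add: backward_shift_pCons)
  qed
qed

subsection \<open>Zeros on a vertical line\<close>

lemma mult_less_le_mono: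
  fixes a b c d :: real
  assumes "a < b" "0 \<le> a" "c \<le> d" "0 < d"
  shows "a * c < b * d"
  using mult_left_mono[of c d a] mult_strict_right_mono[of a b d] assms by linarith

text \<open>The line Re z = s is the perpendicular bisector of \<open>b\<close> and
  \<open>a + 1\<close>, with \<open>b\<close> on its left. It is applied with a = b a zero of a
  polynomial, and with a = 0, b = -k.\<close>

lemma cmod_reflect:
  assumes "Re a + Re b + 1 = 2 * s" "Im a = Im b" "Re b < Re a + 1"
  shows "Re z < s \<Longrightarrow> cmod (z - b) < cmod (z - 1 - a)"
    and "s < Re z \<Longrightarrow> cmod (z - 1 - a) < cmod (z - b)"
proof -
  have s: "s = (Re a + Re b + 1) / 2"
    using assms(1) by simp
  have diff: "(cmod (z - 1 - a))\<^sup>2 - (cmod (z - b))\<^sup>2 = 2 * ((Re a + 1 - Re b) * (s - Re z))"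
    using assms(2) unfolding s cmod_power2 by (simp add: power2_eq_square field_simps)
  show "cmod (z - b) < cmod (z - 1 - a)" if "Re z < s"
  proof -
    have "0 < (Re a + 1 - Re b) * (s - Re z)"
      using that assms(3) by simp
    then have "(cmod (z - b))\<^sup>2 < (cmod (z - 1 - a))\<^sup>2"
      using diff by linarith
    then show ?thesis
      by (rule power2_less_imp_less) simp
  qed
  show "cmod (z - 1 - a) < cmod (z - b)" if "s < Re z"
  proof -
    have "(Re a + 1 - Re b) * (s - Re z) < 0"
      using that assms(3) by (simp add: mult_less_0_iff)
    then have "(cmod (z - 1 - a))\<^sup>2 < (cmod (z - b))\<^sup>2"
      using diff by linarith
    then show ?thesis
      by (rule power2_less_imp_less) simp
  qed
qed

text \<open>Both moduli are products of distances to the zeros, and the factors compare in the same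
  direction. The weak inequality is carried along because constants give equality; a single zero
  makes it strict.\<close>

lemma cmod_poly_shift_compare:
  fixes F :: "complex poly"
  assumes "F \<noteq> 0" "\<And>z. poly F z = 0 \<Longrightarrow> Re z = c"
  shows "Re z < c + 1/2 \<Longrightarrow> cmod (poly F z) \<le> cmod (poly F (z - 1)) \<and>
           (degree F \<noteq> 0 \<longrightarrow> cmod (poly F z) < cmod (poly F (z - 1)))"
    and "c + 1/2 < Re z \<Longrightarrow> cmod (poly F (z - 1)) \<le> cmod (poly F z) \<and>
           (degree F \<noteq> 0 \<longrightarrow> cmod (poly F (z - 1)) < cmod (poly F z))"
  using assms
proof (induction F rule: poly_root_induct[where P = "\<lambda>_. True"])
  case (no_roots p)
  have "constant (poly p)"
    using no_roots(1) fundamental_theorem_of_algebra by blast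
  then have "degree p = 0"
    by (simp add: constant_degree)
  then obtain k where "p = [:k:]"
    by (rule degree_eq_zeroE)
  {
    case 1
    show ?case using \<open>p = [:k:]\<close> by simp
  next
    case 2
    show ?case using \<open>p = [:k:]\<close> by simp
  }
next
  case (root u g)
  have ev: "cmod (poly ([:u, -1:] * g) w) = cmod (w - u) * cmod (poly g w)" for w
    using norm_mult[of "u - w" "poly g w"] by (simp add: norm_minus_commute algebra_simps)
  {
    case 1
    have g: "g \<noteq> 0" "\<And>z. poly g z = 0 \<Longrightarrow> Re z = c" and u: "Re u = c"
      using 1(2,3) by auto
    have le: "cmod (poly g z) \<le> cmod (poly g (z - 1))"
      using root.IH(1)[OF 1(1) g] by blast
    \<comment> \<open>A strict inequality between the products needs the larger factor of
      \<open>g\<close> to be positive; \<open>z - 1\<close> lies strictly to the left of the line of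
      zeros.\<close>
    have "poly g (z - 1) \<noteq> 0"
      using g(2)[of "z - 1"] 1(1) by auto
    moreover have "cmod (z - u) < cmod (z - 1 - u)"
      using cmod_reflect(1)[of u u "c + 1/2" z] u 1(1) by simp
    ultimately have "cmod (z - u) * cmod (poly g z) < cmod (z - 1 - u) * cmod (poly g (z - 1))"
      using le by (intro mult_less_le_mono) auto
    then show ?case
      unfolding ev by simp
  next
    case 2
    have g: "g \<noteq> 0" "\<And>z. poly g z = 0 \<Longrightarrow> Re z = c" and u: "Re u = c"
      using 2(2,3) by auto
    have le: "cmod (poly g (z - 1)) \<le> cmod (poly g z)"
      using root.IH(2)[OF 2(1) g] by blast
    have "poly g z \<noteq> 0"
      using g(2)[of z] 2(1) by auto
    moreover have "cmod (z - 1 - u) < cmod (z - u)"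
      using cmod_reflect(2)[of u u "c + 1/2" z] u 2(1) by simp
    ultimately have "cmod (z - 1 - u) * cmod (poly g (z - 1)) < cmod (z - u) * cmod (poly g z)"
      using le by (intro mult_less_le_mono) auto
    then show ?case
      unfolding ev by simp
  }
qed auto

lemma Re_root_smult_minus_backward_shift:
  fixes F :: "complex poly"
  assumes "\<And>z. poly F z = 0 \<Longrightarrow> Re z = c" "cmod u = 1"
    and "smult u F - backward_shift F \<noteq> 0"
    and root: "poly (smult u F - backward_shift F) z = 0"
  shows "Re z = c + 1/2"
proof -
  have "F \<noteq> 0"
    using assms(3) by auto
  \<comment> \<open>For constant \<open>F\<close> the polynomial
    \<open>smult u F - backward_shift F\<close> would be a nonzero constant and have no zero. The
    strict comparison is thus available.\<close>
  have "degree F \<noteq> 0"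
  proof
    assume "degree F = 0"
    then obtain k where k: "F = [:k:]"
      by (rule degree_eq_zeroE)
    with assms(3) root show False
      by (simp add: backward_shift_pCons split: if_splits)
  qed
  have "u * poly F z = poly F (z - 1)"
    using root by (simp add: poly_backward_shift)
  then have "cmod (poly F z) = cmod (poly F (z - 1))"
    using assms(2) by (metis mult_1 norm_mult)
  then show ?thesis
    using cmod_poly_shift_compare[OF \<open>F \<noteq> 0\<close> assms(1), where z = z] \<open>degree F \<noteq> 0\<close>
    by (metis less_irrefl linorder_neqE_linordered_idom)
qed

text \<open>A zero gives |z + k| |F(z)| = |z - 1| |F(z - 1)|. The points -k and 1 are symmetric
  about Re z = (1 - k)/2, the same line that separates the two cases for \<open>F\<close>, so both
  comparisons agree off it. The linear factors supply strictness, even when \<open>F\<close> is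
  constant.\<close>

lemma Re_root_falling_factorial_step:
  fixes F :: "complex poly"
  assumes "F \<noteq> 0" "\<And>z. poly F z = 0 \<Longrightarrow> Re z = - real k / 2" "cmod u = 1"
    and root: "poly (smult u ([:of_nat k, 1:] * F) - [:-1, 1:] * backward_shift F) z = 0"
  shows "Re z = (1 - real k) / 2"
proof (rule ccontr)
  let ?b = "- of_nat k :: complex" and ?c = "- real k / 2"
  assume "Re z \<noteq> (1 - real k) / 2"
  then have neq: "Re z \<noteq> ?c + 1/2"
    by (simp add: diff_divide_distrib)
  have "u * ((z - ?b) * poly F z) = (z - 1) * poly F (z - 1)"
    using root by (simp add: poly_backward_shift algebra_simps)
  then have "cmod (u * ((z - ?b) * poly F z)) = cmod ((z - 1) * poly F (z - 1))"
    by simp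
  then have eq: "cmod (z - ?b) * cmod (poly F z) = cmod (z - 1) * cmod (poly F (z - 1))"
    using assms(3) by (simp add: norm_mult)
  note cmp = cmod_poly_shift_compare[OF assms(1,2), where z = z]
  consider "Re z < ?c + 1/2" | "?c + 1/2 < Re z"
    using neq by linarith
  then show False
  proof cases
    case 1
    have "poly F (z - 1) \<noteq> 0"
      using assms(2)[of "z - 1"] 1 by auto
    moreover have "cmod (z - ?b) < cmod (z - 1)"
      using cmod_reflect(1)[of 0 ?b "?c + 1/2" z] 1 by simp
    ultimately have "cmod (z - ?b) * cmod (poly F z) < cmod (z - 1) * cmod (poly F (z - 1))"
      using cmp(1) 1 by (intro mult_less_le_mono) auto
    with eq show False by simp
  next
    case 2
    have "poly F z \<noteq> 0"
      using assms(2)[of z] 2 by auto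
    moreover have "cmod (z - 1) < cmod (z - ?b)"
      using cmod_reflect(2)[of 0 ?b "?c + 1/2" z] 2 by simp
    ultimately have "cmod (z - 1) * cmod (poly F (z - 1)) < cmod (z - ?b) * cmod (poly F z)"
      using cmp(2) 2 by (intro mult_less_le_mono) auto
    with eq show False by simp
  qed
qed

subsection \<open>Falling factorials\<close>

lemma falling_factorial_Suc:
  "falling_factorial a (Suc k) = a * falling_factorial (a - 1) k"
  unfolding falling_factorial_def prod.lessThan_Suc_shift by (simp add: algebra_simps)

lemma falling_factorial_poly_Suc:
  "falling_factorial_poly c (Suc k) = [:c, 1:] * falling_factorial_poly (c - 1) k"
  unfolding falling_factorial_poly_def falling_factorial_Suc by (simp add: one_pCons)

lemma backward_shift_falling_factorial_poly:
  "backward_shift (falling_factorial_poly c k) = falling_factorial_poly (c - 1) k"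
proof -
  have "backward_shift ([:c, 1:] - of_nat i) = [:c - 1, 1:] - of_nat i" for i
    by (simp add: backward_shift_def pcompose_pCons pcompose_diff of_nat_poly)
  then show ?thesis
    by (simp add: falling_factorial_poly_def falling_factorial_def backward_shift_prod)
qed

lemma falling_factorial_poly_Suc':
  "falling_factorial_poly c (Suc k) = falling_factorial_poly c k * [:c - of_nat k, 1:]"
  by (simp add: falling_factorial_poly_def falling_factorial_def of_nat_poly)

lemma falling_factorial_poly_nonzero_degree:
  fixes c :: "'a::idom"
  shows "falling_factorial_poly c k \<noteq> 0 \<and> degree (falling_factorial_poly c k) = k"
proof (induction k)
  case 0
  then show ?case by (simp add: falling_factorial_poly_def falling_factorial_def)
next
  case (Suc k)
  then have "degree (falling_factorial_poly c k * [:c - of_nat k, 1:]) = k + 1"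
    by (subst degree_mult_eq) auto
  then show ?case
    using Suc unfolding falling_factorial_poly_Suc' by auto
qed

text \<open>Splitting the first factor off (q + k)_{k+1} and the last off its shift (q + k -
  1)_{k+1} leaves the common part (q + k - 1)_k.\<close>

lemma falling_factorial_poly_step:
  "smult u (falling_factorial_poly (of_nat k) (Suc k) * Q) -
     backward_shift (falling_factorial_poly (of_nat k) (Suc k) * Q) =
   falling_factorial_poly (of_nat k - 1) k *
     (smult u ([:of_nat k, 1:] * Q) - [:-1, 1:] * backward_shift Q)"
proof -
  have shift: "backward_shift (falling_factorial_poly (of_nat k :: 'a) (Suc k)) =
      falling_factorial_poly (of_nat k - 1) k * [:-1, 1:]"
    unfolding backward_shift_falling_factorial_poly by (simp add: falling_factorial_poly_Suc')
  show ?thesis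
    unfolding backward_shift_mult shift unfolding falling_factorial_poly_Suc
    by (simp only: algebra_simps mult_smult_left mult_smult_right smult_diff_right)
qed

subsection \<open>The zeros of \<open>P\<close>\<close>

text \<open>Both ranges of \<open>d\<close> are proved in one induction because the first feeds the
  second: they overlap at d = n - 1, where the split-off factor is just q, whose zero 0 lies on the
  line Re z = 0. The guard \<open>P \<noteq> 0\<close> is there because \<open>P\<close> vanishes if
  1 is a zero of multiplicity above \<open>n\<close>.\<close>

lemma poly_of_operator_falling_factorial_zeros:
  fixes g :: "complex poly"
  assumes "n \<ge> 1" "g \<noteq> 0" "\<And>z. poly g z = 0 \<Longrightarrow> cmod z = 1"
  defines "P \<equiv> poly_of_operator g backward_shift (falling_factorial_poly (of_nat n - 1) n)"
    and "d \<equiv> degree g"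
  shows "(d \<le> n - 1 \<longrightarrow>
           (\<exists>Q. P = falling_factorial_poly (of_nat n - of_nat d - 1) (n - d) * Q \<and> Q \<noteq> 0 \<and>
                (\<forall>z. poly Q z = 0 \<longrightarrow> Re z = (real d - real n + 1) / 2))) \<and>
         (d \<ge> n - 1 \<longrightarrow> P \<noteq> 0 \<longrightarrow>
           (\<forall>z. poly P z = 0 \<longrightarrow> Re z = (real d - real n + 1) / 2))"
  using assms(2,3) unfolding P_def d_def
proof (induction g rule: poly_root_induct[where P = "\<lambda>_. True"])
  case 0
  then show ?case by simp
next
  case (no_roots p)
  then have "constant (poly p)"
    using fundamental_theorem_of_algebra by blast
  then obtain a where a: "p = [:a:]" "a \<noteq> 0"
    using no_roots by (metis constant_degree degree_eq_zeroE pCons_0_0)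
  \<comment> \<open>With d = 0 the second range occurs only for n = 1, where \<open>P\<close> is a
    constant times q.\<close>
  have "falling_factorial_poly (0::complex) 1 = [:0, 1:]"
    by (simp add: falling_factorial_poly_def falling_factorial_def)
  then show ?case
    using a \<open>n \<ge> 1\<close> by (auto simp: poly_of_operator_const intro!: exI[of _ "[:a:]"])
next
  case (root u g)
  let ?c = "\<lambda>d. (real d - real n + 1) / 2"
  let ?P = "\<lambda>g. poly_of_operator g backward_shift (falling_factorial_poly (of_nat n - 1) n)"
  have g: "g \<noteq> 0" "\<And>z. poly g z = 0 \<Longrightarrow> cmod z = 1" and u: "cmod u = 1"
    using root.prems by auto
  note IH = root.IH[OF g]
  have d: "degree ([:u, -1:] * g) = Suc (degree g)"
    using g(1) by (subst degree_mult_eq) auto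
  have c: "?c (Suc (degree g)) = ?c (degree g) + 1/2"
    by simp
  have step: "?P ([:u, -1:] * g) = smult u (?P g) - backward_shift (?P g)"
    by (rule poly_of_operator_backward_shift_linear_factor)
  show ?case
  proof (cases "degree g \<ge> n - 1")
    case True
    have "Re z = ?c (Suc (degree g))"
      if "?P ([:u, -1:] * g) \<noteq> 0" "poly (?P ([:u, -1:] * g)) z = 0" for z
    proof -
      have nz: "?P g \<noteq> 0"
        using that(1) unfolding step by auto
      show ?thesis
        unfolding c using IH True nz that u unfolding step
        by (intro Re_root_smult_minus_backward_shift) auto
    qed
    then show ?thesis
      using True unfolding d by (auto simp del: mult_pCons_left)
  next
    case False
    \<comment> \<open>In terms of \<open>k\<close>, the factor before the step is (q + k)_{k+1} and
      the line is Re z = -k/2; afterwards they are (q + k - 1)_k and Re z = (1 - k)/2.\<close>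
    define k where "k = n - degree g - 1"
    have k: "n = degree g + Suc k"
      using False by (simp add: k_def)
    then have "k \<ge> 1"
      using False by simp
    obtain Q where Q: "?P g = falling_factorial_poly (of_nat k) (Suc k) * Q" "Q \<noteq> 0"
      "\<And>z. poly Q z = 0 \<Longrightarrow> Re z = - real k / 2"
      using IH k by auto
    define R where "R = smult u ([:of_nat k, 1:] * Q) - [:-1, 1:] * backward_shift Q"
    have PR: "?P ([:u, -1:] * g) = falling_factorial_poly (of_nat k - 1) k * R"
      unfolding step Q(1) R_def by (rule falling_factorial_poly_step)
    have roots: "Re z = (1 - real k) / 2" if "poly R z = 0" for z
      using Re_root_falling_factorial_step[OF Q(2,3) u, where z = z] that unfolding R_def by blast
    \<comment> \<open>If \<open>R\<close> were zero, both 0 and 1 would count as its zeros, and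
      \<open>roots\<close> would put them on one vertical line.\<close>
    have R: "R \<noteq> 0"
    proof
      assume "R = 0"
      then have "Re 0 = (1 - real k) / 2" "Re 1 = (1 - real k) / 2"
        using roots[of 0] roots[of 1] by auto
      then show False by simp
    qed
    \<comment> \<open>Entry into the second range: here k = 1, so P = q R, and the extra zero 0 lies
      on the line Re z = 0.\<close>
    have "Re z = ?c (Suc (degree g))"
      if "n - 1 = Suc (degree g)" "poly (?P ([:u, -1:] * g)) z = 0" for z
    proof -
      have "k = 1"
        using that(1) k by simp
      then show ?thesis
        using that(2) roots[of z] k unfolding PR
        by (auto simp: falling_factorial_poly_def falling_factorial_def)
    qed
    moreover have "of_nat n - of_nat (Suc (degree g)) - 1 = (of_nat k - 1 :: complex)"
      "n - Suc (degree g) = k" "?c (Suc (degree g)) = (1 - real k) / 2"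
      using k by auto
    ultimately show ?thesis
      using PR R roots False unfolding d
      by (intro conjI impI exI[of _ R]) (auto simp del: mult_pCons_left)
  qed
qed

text \<open>The second range is split at m = n because (1 - E)^{n+1} annihilates every polynomial of
  degree \<open>n\<close>. In the first range m \<le> d < n, so no split arises.\<close>

theorem theorem4:
  fixes n d m :: nat and g P :: "complex poly"
  assumes "n \<ge> 1"
    and "g \<noteq> 0" and "degree g = d"
    and "\<And>z. poly g z = 0 \<Longrightarrow> cmod z = 1"
    and "m = order 1 g"
    and "P = poly_of_operator g backward_shift (falling_factorial_poly (of_nat n - 1) n)"
  shows "(d \<le> n - 1 \<longrightarrow>
           (\<exists>Q. P = falling_factorial_poly (of_nat n - of_nat d - 1) (n - d) * Q \<and>
                Q \<noteq> 0 \<and> degree Q = d - m \<and>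
                (\<forall>z. poly Q z = 0 \<longrightarrow> Re z = (real d - real n + 1) / 2))) \<and>
         (d \<ge> n - 1 \<longrightarrow>
           (m \<le> n \<longrightarrow>
             P \<noteq> 0 \<and> degree P = n - m \<and>
             (\<forall>z. poly P z = 0 \<longrightarrow> Re z = (real d - real n + 1) / 2)) \<and>
           (m > n \<longrightarrow> P = 0))"
proof -
  let ?f = "falling_factorial_poly (of_nat n - 1 :: complex) n"
  have f: "?f \<noteq> 0" "degree ?f = n"
    using falling_factorial_poly_nonzero_degree by blast+
  have deg: "if m \<le> n then P \<noteq> 0 \<and> degree P = n - m else P = 0"
    using degree_poly_of_operator_backward_shift[OF assms(2) f(1)] f(2) assms(5,6) by simp
  note zeros = poly_of_operator_falling_factorial_zeros[OF assms(1,2,4), folded assms(6),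
      unfolded assms(3)]
  \<comment> \<open>Comparison of degrees: n - m = (n - d) + deg Q, with m \<le> d making the
    natural subtractions exact.\<close>
  have degQ: "degree Q = d - m"
    if "d \<le> n - 1" "P = falling_factorial_poly (of_nat n - of_nat d - 1) (n - d) * Q" "Q \<noteq> 0" for Q
  proof -
    have "m \<le> d"
      using order_degree[OF assms(2), of 1] assms(3,5) by simp
    moreover have "degree P = (n - d) + degree Q"
      unfolding that(2) using that(3) falling_factorial_poly_nonzero_degree
      by (subst degree_mult_eq) auto
    ultimately show ?thesis
      using deg that(1) by auto
  qed
  show ?thesis
  proof (intro conjI impI)
    assume d: "d \<le> n - 1"
    then obtain Q where "P = falling_factorial_poly (of_nat n - of_nat d - 1) (n - d) * Q" "Q \<noteq> 0"
      "\<forall>z. poly Q z = 0 \<longrightarrow> Re z = (real d - real n + 1) / 2"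
      using zeros by blast
    with degQ[OF d] show "\<exists>Q. P = falling_factorial_poly (of_nat n - of_nat d - 1) (n - d) * Q \<and>
        Q \<noteq> 0 \<and> degree Q = d - m \<and>
        (\<forall>z. poly Q z = 0 \<longrightarrow> Re z = (real d - real n + 1) / 2)"
      by blast
  next
    assume "n - 1 \<le> d" "m \<le> n"
    then show "P \<noteq> 0" "degree P = n - m"
      "\<forall>z. poly P z = 0 \<longrightarrow> Re z = (real d - real n + 1) / 2"
      using zeros deg by auto
  next
    assume "m > n"
    then show "P = 0"
      using deg by simp
  qed
qed

end
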